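(* Let $M=(a,b,c,d,u_0,\omega_0)$ be real parameters with $ad-bc=1$ and $b\neq 0$. Let $f_1\in L^2(\mathbb{R})$ and let $\mathcal{O}_{g_1}[f_1](u,\tau)$ be the convolution-based short-time offset linear canonical transform of $f_1$ with respect to the window function $g_1$. If $g_1,g_2\in L^2(\mathbb{R})$ with $\langle g_2,g_1\rangle\neq 0$, then $f_1$ can be reconstructed from $\mathcal{O}_{g_1}[f_1]$ by $$f_1(t)=\frac{1}{\overline{\sqrt{2\pi b i}}\;\langle g_2,g_1\rangle}\int_{\mathbb{R}^2}\mathcal{O}_{g_1}[f_1](u,\tau)\,(g_2)^{M}_{u,\tau}(t)\,du\,d\tau .$$
   Context: $\langle f,h\rangle=\int_{\mathbb{R}}f(t)\overline{h(t)}\,dt$ is the inner product of $L^2(\mathbb{R})$. For real parameters $M=(a,b,c,d,u_0,\omega_0)$ with $ad-bc=1$, $b\neq 0$, and $g\in L^2(\mathbb{R})\setminus\{0\}$, put $$g^{M}_{u,\tau}(t)=g(t-u)\,e^{\frac{i a t}{b}(u-t)-\frac{i}{2b}d u_0^2+i\tau t},\qquad t,u,\tau\in\mathbb{R}.$$ The convolution-based short-time offset linear canonical transform (STOLCT) of $f\in L^2(\mathbb{R})$ with respect to the window $g$ is $$\mathcal{O}_{g}[f](u,\tau)=\frac{1}{\sqrt{2\pi i b}}\langle f,g^{M}_{u,\tau}\rangle=\frac{1}{\sqrt{2\pi i b}}\int_{\mathbb{R}} f(x)\,\overline{g(x-u)}\,e^{-\frac{i a x}{b}(u-x)+\frac{i}{2b}d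 u_0^2-i\tau x}\,dx,\qquad (u,\tau)\in\mathbb{R}^2.$$
   Formalization: The printed constant is corrected by a factor |b|: the right side as printed equals f_1/|b|, so it fails e.g. for a=d=0, b=2, c=-1/2 with Gaussians; the integral over R^2 is taken in the weak L^2 sense and equality holds almost everywhere. *)

theory Defs
  imports "HOL-Analysis.Analysis"
begin

text \<open>
  \<open>L\<^sup>2(\<real>)\<close> is represented by Borel representatives of its classes; equality of elements is
  equality almost everywhere.
\<close>

definition L2 :: "(real \<Rightarrow> complex) set" where
  "L2 = {f. f \<in> borel_measurable lborel \<and> integrable lborel (\<lambda>t. (cmod (f t))\<^sup>2)}"

definition L2_inner :: "(real \<Rightarrow> complex) \<Rightarrow> (real \<Rightarrow> complex) \<Rightarrow> complex" where
  "L2_inner f h = (LINT t|lborel. f t * cnj (h t))"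

text \<open>
  \<open>F\<close> is the integral of the \<open>L\<^sup>2(\<real>)\<close>-valued family \<open>\<Phi>\<close> with respect to \<open>\<mu>\<close>, in the usual weak
  sense: testing against every \<open>h\<close> in \<open>L\<^sup>2(\<real>)\<close> gives an absolutely convergent scalar integral with
  value \<open>\<langle>F, h\<rangle>\<close>. This determines \<open>F\<close> up to a null set. For time-frequency synthesis formulas the
  Lebesgue integral of \<open>\<Phi> p t\<close> over \<open>p\<close> at fixed \<open>t\<close> need not converge.
\<close>

definition has_weak_L2_integral ::
  "'p measure \<Rightarrow> ('p \<Rightarrow> real \<Rightarrow> complex) \<Rightarrow> (real \<Rightarrow> complex) \<Rightarrow> bool" where
  "has_weak_L2_integral \<mu> \<Phi> F \<longleftrightarrow>
     F \<in> L2 \<and> (\<forall>p. \<Phi> p \<in> L2) \<and>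
     (\<forall>h\<in>L2. integrable \<mu> (\<lambda>p. L2_inner (\<Phi> p) h) \<and>
             L2_inner F h = (LINT p|\<mu>. L2_inner (\<Phi> p) h))"

text \<open>Parameters \<open>M = (a, b, c, d, u\<^sub>0, \<omega>\<^sub>0)\<close>.\<close>

type_synonym olct_params = "real \<times> real \<times> real \<times> real \<times> real \<times> real"

fun window_atom :: "olct_params \<Rightarrow> (real \<Rightarrow> complex) \<Rightarrow> real \<Rightarrow> real \<Rightarrow> real \<Rightarrow> complex" where
  "window_atom (a, b, c, d, u\<^sub>0, \<omega>\<^sub>0) g u \<tau> t =
     g (t - u) *
     exp (\<i> * of_real (a * t / b * (u - t)) - \<i> * of_real (d * u\<^sub>0\<^sup>2 / (2 * b)) + \<i> * of_real (\<tau> * t))"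

text \<open>The square root of \<open>2\<pi>ib\<close> is the principal one.\<close>

fun stolct :: "olct_params \<Rightarrow> (real \<Rightarrow> complex) \<Rightarrow> (real \<Rightarrow> complex) \<Rightarrow> real \<Rightarrow> real \<Rightarrow> complex" where
  "stolct (a, b, c, d, u\<^sub>0, \<omega>\<^sub>0) g f u \<tau> =
     1 / csqrt (2 * of_real pi * \<i> * of_real b) *
     L2_inner f (window_atom (a, b, c, d, u\<^sub>0, \<omega>\<^sub>0) g u \<tau>)"

lemma stolct_eq_integral:
  "stolct (a, b, c, d, u\<^sub>0, \<omega>\<^sub>0) g f u \<tau> =
     1 / csqrt (2 * of_real pi * \<i> * of_real b) *
     (LINT x|lborel. f x * cnj (g (x - u)) *
        exp (- \<i> * of_real (a * x / b * (u - x)) + \<i> * of_real (d * u\<^sub>0\<^sup>2 / (2 * b)) - \<i> * of_real (\<tau> * x)))"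
  by (simp add: L2_inner_def exp_cnj mult.assoc)

text \<open>
  On the constant in the inversion formula: by Plancherel in \<open>\<tau>\<close> (where
  \<open>e\<^sup>i\<^sup>\<tau>\<^sup>t\<close> carries no factor \<open>1/b\<close>) the synthesis integral equals
  \<open>2\<pi> / sqrt (2\<pi>ib) \<cdot> \<langle>g\<^sub>2, g\<^sub>1\<rangle> \<cdot> f\<^sub>1\<close>. Since \<open>sqrt (2\<pi>ib) \<cdot> cnj (sqrt (2\<pi>ib)) = 2\<pi>\<bar>b\<bar>\<close>, the
  reconstruction constant is \<open>\<bar>b\<bar> / (cnj (sqrt (2\<pi>bi)) \<cdot> \<langle>g\<^sub>2, g\<^sub>1\<rangle>)\<close>. The factor \<open>\<bar>b\<bar>\<close> is absent from
  the published formula, which is therefore correct only for \<open>\<bar>b\<bar> = 1\<close> (or \<open>f\<^sub>1 = 0\<close>).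
\<close>

end

theory Submission
  imports Defs "HOL-Probability.Characteristic_Functions"
begin

text \<open>
  Up to the constant \<open>1 / sqrt (2\<pi>ib)\<close>, the transform of \<open>f\<close> at \<open>(u, \<tau>)\<close> is the ordinary Fourier transform at
  \<open>\<tau>\<close> of \<open>t \<mapsto> f(t) cnj(g(t - u)) e\<^bsup>-i\<theta>(u,t)\<^esup>\<close> with a real phase \<open>\<theta>\<close> that depends on the parameters
  only. Testing the synthesis integral against \<open>h\<close> therefore gives the integral over \<open>(u, \<tau>)\<close> of the
  transform of \<open>f\<^sub>1\<close> with window \<open>g\<^sub>1\<close> times the conjugate of the transform of \<open>h\<close> with window \<open>g\<^sub>2\<close>.
  Parseval's identity in \<open>\<tau>\<close> turns it into \<open>2\<pi>\<close> times the integral of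
  \<open>f\<^sub>1(t) cnj(h(t)) g\<^sub>2(t - u) cnj(g\<^sub>1(t - u))\<close> over \<open>(u, t)\<close>: the phases cancel. Integrating over \<open>u\<close>
  first leaves \<open>2\<pi> \<langle>g\<^sub>2, g\<^sub>1\<rangle> \<langle>f\<^sub>1, h\<rangle>\<close> (\<open>windowed_fourier_orthogonality\<close>). Hence the weak integral is
  a multiple of \<open>f\<^sub>1\<close>, and the constant follows from \<open>\<bar>sqrt (2\<pi>ib)\<bar>\<^sup>2 = 2\<pi>\<bar>b\<bar>\<close>.

  The analytic input is Parseval's identity for functions in \<open>L\<^sup>1 \<inter> L\<^sup>2\<close>; the fibre over \<open>u\<close>
  is integrable for every \<open>u\<close>, and square integrable for almost every \<open>u\<close>. It is proved by
  Gaussian regularisation. The product \<open>fourier f * cnj (fourier h)\<close> is the Fourier transform of the cross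
  correlation of \<open>f\<close> and \<open>h\<close>, whose value at \<open>0\<close> is \<open>\<langle>f, h\<rangle>\<close>; integrating it against a wide
  Gaussian averages the correlation near \<open>0\<close>. What remains is the continuity of the correlation at
  \<open>0\<close>, which follows from the density of continuous compactly supported functions in \<open>L\<^sup>2\<close>
  (\<open>L2_approx_continuous\<close>).
\<close>

section \<open>Square integrable functions\<close>

lemma cis_measurable [measurable]: "cis \<in> borel_measurable borel"
  by (intro borel_measurable_continuous_onI continuous_intros)

lemma cnj_measurable [measurable]: "cnj \<in> borel_measurable borel"
  by (intro borel_measurable_continuous_onI continuous_intros)

lemma L2_measurable: "f \<in> L2 \<Longrightarrow> f \<in> borel_measurable borel"
  by (simp add: L2_def)

lemma L2_integrable_power2: "f \<in> L2 \<Longrightarrow> integrable lborel (\<lambda>t. (cmod (f t))\<^sup>2)"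
  by (simp add: L2_def)

lemma L2_I: "f \<in> borel_measurable borel \<Longrightarrow> integrable lborel (\<lambda>t. (cmod (f t))\<^sup>2) \<Longrightarrow> f \<in> L2"
  by (simp add: L2_def)

text \<open>
  Used pointwise under an integral, with the weight \<open>s\<close> adapted to the two integrals, this does the
  work of the Cauchy--Schwarz inequality.
\<close>

lemma weighted_young:
  fixes x y s :: real
  assumes "s > 0"
  shows "x * y \<le> (s * x\<^sup>2 + y\<^sup>2 / s) / 2"
proof -
  have "0 \<le> (s * x - y)\<^sup>2 / s" using assms by simp
  also have "\<dots> = s * x\<^sup>2 + y\<^sup>2 / s - 2 * x * y"
    using assms by (simp add: field_simps power2_eq_square)
  finally show ?thesis by simp
qed

lemma integrable_mult_cnj:
  fixes f h :: "'a \<Rightarrow> complex"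
  assumes [measurable]: "f \<in> borel_measurable M" "h \<in> borel_measurable M"
    and "integrable M (\<lambda>t. (cmod (f t))\<^sup>2)" "integrable M (\<lambda>t. (cmod (h t))\<^sup>2)"
  shows "integrable M (\<lambda>t. f t * cnj (h t))"
proof (rule Bochner_Integration.integrable_bound)
  show "integrable M (\<lambda>t. (cmod (f t))\<^sup>2 + (cmod (h t))\<^sup>2)"
    using assms by simp
  have "cmod (f t) * cmod (h t) \<le> (cmod (f t))\<^sup>2 + (cmod (h t))\<^sup>2" for t
  proof -
    have "cmod (f t) * cmod (h t) \<le> ((cmod (f t))\<^sup>2 + (cmod (h t))\<^sup>2) / 2"
      using weighted_young[OF zero_less_one, of "cmod (f t)" "cmod (h t)"] by simp
    also have "\<dots> \<le> (cmod (f t))\<^sup>2 + (cmod (h t))\<^sup>2" by simp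
    finally show ?thesis .
  qed
  then show "AE t in M. norm (f t * cnj (h t)) \<le> norm ((cmod (f t))\<^sup>2 + (cmod (h t))\<^sup>2)"
    by (intro AE_I2) (simp add: norm_mult)
qed measurable

lemma L2_mult_integrable:
  assumes "f \<in> L2" "h \<in> L2"
  shows "integrable lborel (\<lambda>t. f t * cnj (h t))"
  using assms by (intro integrable_mult_cnj) (auto simp: L2_def)

lemma norm_L2_inner_le:
  assumes f: "f \<in> L2" and h: "h \<in> L2" and s: "s > 0"
  shows "norm (L2_inner f h)
    \<le> (s * (LINT t|lborel. (cmod (f t))\<^sup>2) + (LINT t|lborel. (cmod (h t))\<^sup>2) / s) / 2"
proof -
  have "norm (L2_inner f h)
    \<le> (LINT t|lborel. (s * (cmod (f t))\<^sup>2 + (cmod (h t))\<^sup>2 / s) / 2)"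
    unfolding L2_inner_def
  proof (intro order_trans[OF integral_norm_bound] integral_mono integrable_norm L2_mult_integrable f h)
    show "norm (f t * cnj (h t)) \<le> (s * (cmod (f t))\<^sup>2 + (cmod (h t))\<^sup>2 / s) / 2" for t
      using weighted_young[OF s, of "cmod (f t)" "cmod (h t)"] by (simp add: norm_mult)
    show "integrable lborel (\<lambda>t. (s * (cmod (f t))\<^sup>2 + (cmod (h t))\<^sup>2 / s) / 2)"
      using L2_integrable_power2[OF f] L2_integrable_power2[OF h] by simp
  qed
  also have "\<dots> = (s * (LINT t|lborel. (cmod (f t))\<^sup>2) + (LINT t|lborel. (cmod (h t))\<^sup>2) / s) / 2"
    using f h by (simp add: L2_integrable_power2)
  finally show ?thesis .
qed

lemma integral_translate:
  fixes f :: "real \<Rightarrow> 'a :: {banach, second_countable_topology}"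
  shows "(LINT t|lborel. f (t + x)) = (LINT t|lborel. f t)"
  using lborel_integral_real_affine[of 1 f x] by (simp add: add.commute)

lemma integrable_translate:
  fixes f :: "real \<Rightarrow> 'a :: {banach, second_countable_topology}"
  shows "integrable lborel f \<Longrightarrow> integrable lborel (\<lambda>t. f (t + x))"
  using lborel_integrable_real_affine[of f 1 x] by (simp add: add.commute)

lemma L2_translate:
  assumes "f \<in> L2"
  shows "(\<lambda>t. f (t + x)) \<in> L2"
proof (rule L2_I)
  note [measurable] = L2_measurable[OF assms]
  show "(\<lambda>t. f (t + x)) \<in> borel_measurable borel" by measurable
  show "integrable lborel (\<lambda>t. (cmod (f (t + x)))\<^sup>2)"
    using integrable_translate[OF L2_integrable_power2[OF assms]] .
qed

lemma L2_diff:
  assumes "f \<in> L2" "h \<in> L2"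
  shows "(\<lambda>t. f t - h t) \<in> L2"
proof (rule L2_I)
  note [measurable] = L2_measurable[OF assms(1)] L2_measurable[OF assms(2)]
  show "(\<lambda>t. f t - h t) \<in> borel_measurable borel" by measurable
  have "(cmod (f t - h t))\<^sup>2 \<le> 2 * (cmod (f t))\<^sup>2 + 2 * (cmod (h t))\<^sup>2" for t
  proof -
    have "(cmod (f t - h t))\<^sup>2 \<le> (cmod (f t) + cmod (h t))\<^sup>2"
      by (intro power_mono norm_triangle_ineq4) auto
    also have "\<dots> \<le> 2 * (cmod (f t))\<^sup>2 + 2 * (cmod (h t))\<^sup>2"
      using weighted_young[of 1 "cmod (f t)" "cmod (h t)"] by (simp add: power2_sum)
    finally show ?thesis .
  qed
  then show "integrable lborel (\<lambda>t. (cmod (f t - h t))\<^sup>2)"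
    by (intro Bochner_Integration.integrable_bound[where
          f = "\<lambda>t. 2 * (cmod (f t))\<^sup>2 + 2 * (cmod (h t))\<^sup>2" and g = "\<lambda>t. (cmod (f t - h t))\<^sup>2"])
       (use L2_integrable_power2[OF assms(1)] L2_integrable_power2[OF assms(2)] in auto)
qed

section \<open>Density of continuous functions with compact support\<close>

lemma integrable_indicator_Icc: "integrable lborel (indicator {a..b::real} :: real \<Rightarrow> real)"
  by (rule integrable_real_indicator) (auto simp: emeasure_lborel_Icc_eq)

text \<open>
  The modification of a value \<open>z\<close> taken at the point \<open>t\<close> which scales it back to modulus at most
  \<open>K\<close> and multiplies it by a tent vanishing outside \<open>{-K..K}\<close>. Both factors are continuous, so
  applying it to a continuous function of \<open>t\<close> gives a continuous function that is bounded and
  supported in \<open>{-K..K}\<close>.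
\<close>

definition clamp_cutoff :: "real \<Rightarrow> complex \<Rightarrow> real \<Rightarrow> complex" where
  "clamp_cutoff K z t = of_real (max 0 (1 - \<bar>t\<bar> / K) / max 1 (cmod z / K)) * z"

lemma norm_clamp_cutoff:
  assumes "K > 0"
  shows "cmod (clamp_cutoff K z t) \<le> cmod z"
    and "cmod (clamp_cutoff K z t) \<le> K * indicator {-K..K} t"
proof -
  have 1: "max 0 (1 - \<bar>t\<bar> / K) \<le> indicator {-K..K} t"
    using assms by (auto simp: indicator_def max_def field_simps)
  then have 2: "max 0 (1 - \<bar>t\<bar> / K) \<le> 1" by (rule order_trans) (auto simp: indicator_def)
  have "max 0 (1 - \<bar>t\<bar> / K) / max 1 (cmod z / K) \<le> 1 / 1"
    using 2 by (intro frac_le) auto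
  then have "max 0 (1 - \<bar>t\<bar> / K) / max 1 (cmod z / K) * cmod z \<le> 1 * cmod z"
    by (intro mult_right_mono) auto
  then show "cmod (clamp_cutoff K z t) \<le> cmod z"
    by (simp add: clamp_cutoff_def norm_mult norm_divide)
  have "cmod z / max 1 (cmod z / K) \<le> K"
    using assms by (auto simp: max_def field_simps)
  then have "max 0 (1 - \<bar>t\<bar> / K) * (cmod z / max 1 (cmod z / K)) \<le> indicator {-K..K} t * K"
    using 1 by (intro mult_mono) auto
  then show "cmod (clamp_cutoff K z t) \<le> K * indicator {-K..K} t"
    by (simp add: clamp_cutoff_def norm_mult norm_divide mult.commute)
qed

lemma clamp_cutoff_tendsto: "(\<lambda>k. clamp_cutoff (real (Suc k)) z t) \<longlonglongrightarrow> z"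
proof -
  have inv: "(\<lambda>k. c / real (Suc k)) \<longlonglongrightarrow> 0" for c :: real
    using LIMSEQ_Suc[OF lim_const_over_n[of c]] by simp
  have "(\<lambda>k. of_real (max 0 (1 - \<bar>t\<bar> / real (Suc k)) / max 1 (cmod z / real (Suc k))) * z)
      \<longlonglongrightarrow> of_real (max 0 (1 - 0) / max 1 0) * z"
    by (intro tendsto_intros inv) auto
  then show ?thesis by (simp add: clamp_cutoff_def)
qed

lemma continuous_clamp_cutoff:
  assumes "continuous_on UNIV \<psi>" "K > 0"
  shows "continuous_on UNIV (\<lambda>t. clamp_cutoff K (\<psi> t) t)"
  unfolding clamp_cutoff_def using assms by (intro continuous_intros) auto

lemma bounded_support_in_L2:
  assumes [measurable]: "\<phi> \<in> borel_measurable borel"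
    and le: "\<And>t. cmod (\<phi> t) \<le> K * indicator {-K..K} t"
  shows "\<phi> \<in> L2"
proof (rule L2_I[OF assms(1)])
  show "integrable lborel (\<lambda>t. (cmod (\<phi> t))\<^sup>2)"
  proof (rule Bochner_Integration.integrable_bound)
    show "integrable lborel (\<lambda>t. K\<^sup>2 * indicator {-K..K} t :: real)"
      by (intro integrable_mult_right integrable_indicator_Icc)
    have "(cmod (\<phi> t))\<^sup>2 \<le> K\<^sup>2 * indicator {-K..K} t" for t
      using power_mono[OF le[of t], of 2] by (auto simp: indicator_def split: if_splits)
    then show "AE t in lborel. norm ((cmod (\<phi> t))\<^sup>2) \<le> norm (K\<^sup>2 * indicator {-K..K} t :: real)"
      by (intro AE_I2) (simp add: abs_mult)
  qed measurable
qed

text \<open>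
  Truncation first: \<open>clamp_cutoff K (h t) t\<close> is dominated by \<open>h\<close> and tends to it as \<open>K\<close> grows.
  For fixed \<open>K\<close>, the measurable function \<open>h\<close> is an almost everywhere limit of continuous functions
  \<open>\<psi>\<^sub>n\<close>. Nothing is known about the size of \<open>\<psi>\<^sub>n\<close>, but applying the same truncation to them makes
  them uniformly bounded with common compact support, and dominated convergence applies again.
\<close>

lemma L2_approx_continuous:
  assumes h: "h \<in> L2" and e: "e > 0"
  obtains \<phi> K where "K > 0" "continuous_on UNIV \<phi>" "\<phi> \<in> L2"
    "\<And>t. cmod (\<phi> t) \<le> K * indicator {-K..K} t"
    "(LINT t|lborel. (cmod (h t - \<phi> t))\<^sup>2) < e"
proof -
  note [measurable] = L2_measurable[OF h]
  have clamp_meas [measurable]: "(\<lambda>t. clamp_cutoff K (f t) t) \<in> borel_measurable borel"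
    if [measurable]: "f \<in> borel_measurable borel" for K f
    unfolding clamp_cutoff_def by measurable
  have "(\<lambda>k. LINT t|lborel. (cmod (h t - clamp_cutoff (real (Suc k)) (h t) t))\<^sup>2)
      \<longlonglongrightarrow> (LINT t|lborel. (cmod (h t - h t))\<^sup>2)"
  proof (rule integral_dominated_convergence[where w = "\<lambda>t. 4 * (cmod (h t))\<^sup>2"])
    show "integrable lborel (\<lambda>t. 4 * (cmod (h t))\<^sup>2)" using h by (simp add: L2_integrable_power2)
    show "AE t in lborel. (\<lambda>k. (cmod (h t - clamp_cutoff (real (Suc k)) (h t) t))\<^sup>2)
        \<longlonglongrightarrow> (cmod (h t - h t))\<^sup>2"
      by (intro AE_I2 tendsto_intros clamp_cutoff_tendsto)
    have "(cmod (h t - clamp_cutoff (real (Suc k)) (h t) t))\<^sup>2 \<le> (2 * cmod (h t))\<^sup>2" for k t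
      using norm_clamp_cutoff(1)[of "real (Suc k)" "h t" t]
      by (intro power_mono) (auto intro!: order_trans[OF norm_triangle_ineq4])
    then show "AE t in lborel. norm ((cmod (h t - clamp_cutoff (real (Suc k)) (h t) t))\<^sup>2)
        \<le> 4 * (cmod (h t))\<^sup>2" for k
      by (intro AE_I2) (simp add: power_mult_distrib)
  qed measurable
  then have "\<forall>\<^sub>F k in sequentially.
      (LINT t|lborel. (cmod (h t - clamp_cutoff (real (Suc k)) (h t) t))\<^sup>2) < e / 4"
    using e by (intro order_tendstoD(2)) auto
  then obtain k where
    k: "(LINT t|lborel. (cmod (h t - clamp_cutoff (real (Suc k)) (h t) t))\<^sup>2) < e / 4"
    by (auto simp: eventually_sequentially)
  define K where "K = real (Suc k)"
  have K: "K > 0" by (simp add: K_def)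
  let ?h = "\<lambda>t. clamp_cutoff K (h t) t"
  have h_leb: "h \<in> borel_measurable lebesgue"
    by (simp add: measurable_completion)
  then obtain N \<psi> where N: "negligible N" and \<psi>: "\<And>n. continuous_on UNIV (\<psi> n)"
    and lim: "\<And>t. t \<notin> N \<Longrightarrow> (\<lambda>n. \<psi> n t) \<longlonglongrightarrow> h t"
    using lebesgue_measurable_imp_measurable_on[OF h_leb, of UNIV] by (auto simp: measurable_on_def)
  have [measurable]: "\<psi> n \<in> borel_measurable borel" for n
    by (intro borel_measurable_continuous_onI \<psi>)
  \<comment> \<open>The exceptional set is only Lebesgue measurable; the convergence set of Borel functions is
    Borel, so the statement descends from the completion.\<close>
  have ae: "AE t in lborel. (\<lambda>n. \<psi> n t) \<longlonglongrightarrow> h t"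
  proof -
    have "AE t in lebesgue. (\<lambda>n. \<psi> n t) \<longlonglongrightarrow> h t"
      using N lim by (intro AE_I'[of N]) (auto simp: negligible_iff_null_sets)
    then show ?thesis by (subst (asm) AE_completion_iff) measurable
  qed
  have h': "?h \<in> L2"
    using K norm_clamp_cutoff(2) by (intro bounded_support_in_L2[of _ K]) auto
  have \<phi>: "(\<lambda>t. clamp_cutoff K (\<psi> n t) t) \<in> L2" for n
    using K norm_clamp_cutoff(2) by (intro bounded_support_in_L2[of _ K]) auto
  have "(\<lambda>n. LINT t|lborel. (cmod (?h t - clamp_cutoff K (\<psi> n t) t))\<^sup>2)
      \<longlonglongrightarrow> (LINT t|lborel. (cmod (?h t - ?h t))\<^sup>2)"
  proof (rule integral_dominated_convergence[where w = "\<lambda>t. 4 * K\<^sup>2 * indicator {-K..K} t"])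
    show "integrable lborel (\<lambda>t. 4 * K\<^sup>2 * indicator {-K..K} t :: real)"
      by (intro integrable_mult_right integrable_indicator_Icc)
    show "AE t in lborel. (\<lambda>n. (cmod (?h t - clamp_cutoff K (\<psi> n t) t))\<^sup>2) \<longlonglongrightarrow> (cmod (?h t - ?h t))\<^sup>2"
      using ae unfolding clamp_cutoff_def by eventually_elim (intro tendsto_intros, use K in auto)
    have "(cmod (?h t - clamp_cutoff K (\<psi> n t) t))\<^sup>2 \<le> (2 * (K * indicator {-K..K} t))\<^sup>2" for n t
      using norm_clamp_cutoff(2)[OF K, of "h t" t] norm_clamp_cutoff(2)[OF K, of "\<psi> n t" t]
      by (intro power_mono order_trans[OF norm_triangle_ineq4]) auto
    also have "(2 * (K * indicator {-K..K} t))\<^sup>2 = 4 * K\<^sup>2 * indicator {-K..K} t" for t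
      by (simp add: power_mult_distrib indicator_def)
    finally show "AE t in lborel. norm ((cmod (?h t - clamp_cutoff K (\<psi> n t) t))\<^sup>2)
        \<le> 4 * K\<^sup>2 * indicator {-K..K} t" for n
      by (intro AE_I2) simp
  qed measurable
  then have "\<forall>\<^sub>F n in sequentially.
      (LINT t|lborel. (cmod (?h t - clamp_cutoff K (\<psi> n t) t))\<^sup>2) < e / 4"
    using e by (intro order_tendstoD(2)) auto
  then obtain n where n: "(LINT t|lborel. (cmod (?h t - clamp_cutoff K (\<psi> n t) t))\<^sup>2) < e / 4"
    by (auto simp: eventually_sequentially)
  let ?\<phi> = "\<lambda>t. clamp_cutoff K (\<psi> n t) t"
  have sq: "(cmod (h t - ?\<phi> t))\<^sup>2 \<le> 2 * (cmod (h t - ?h t))\<^sup>2 + 2 * (cmod (?h t - ?\<phi> t))\<^sup>2" for t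
  proof -
    have "(cmod (h t - ?\<phi> t))\<^sup>2 \<le> (cmod (h t - ?h t) + cmod (?h t - ?\<phi> t))\<^sup>2"
      by (intro power_mono norm_diff_triangle_le order_refl) auto
    also have "\<dots> \<le> 2 * (cmod (h t - ?h t))\<^sup>2 + 2 * (cmod (?h t - ?\<phi> t))\<^sup>2"
      using weighted_young[of 1 "cmod (h t - ?h t)" "cmod (?h t - ?\<phi> t)"] by (simp add: power2_sum)
    finally show ?thesis .
  qed
  have i1: "integrable lborel (\<lambda>t. (cmod (h t - ?h t))\<^sup>2)"
    and i2: "integrable lborel (\<lambda>t. (cmod (?h t - ?\<phi> t))\<^sup>2)"
    and i3: "integrable lborel (\<lambda>t. (cmod (h t - ?\<phi> t))\<^sup>2)"
    by (intro L2_integrable_power2 L2_diff h h' \<phi>)+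
  have "(LINT t|lborel. (cmod (h t - ?\<phi> t))\<^sup>2)
      \<le> (LINT t|lborel. 2 * (cmod (h t - ?h t))\<^sup>2 + 2 * (cmod (?h t - ?\<phi> t))\<^sup>2)"
    using sq i1 i2 i3 by (intro integral_mono) auto
  also have "\<dots> = 2 * (LINT t|lborel. (cmod (h t - ?h t))\<^sup>2) + 2 * (LINT t|lborel. (cmod (?h t - ?\<phi> t))\<^sup>2)"
    using i1 i2 by simp
  also have "\<dots> < e" using k n by (simp add: K_def)
  finally show ?thesis
    using K \<psi> \<phi> norm_clamp_cutoff(2)[OF K]
    by (intro that[of K ?\<phi>] continuous_clamp_cutoff) auto
qed

section \<open>Continuity of the cross correlation\<close>

definition cross_correlation :: "(real \<Rightarrow> complex) \<Rightarrow> (real \<Rightarrow> complex) \<Rightarrow> real \<Rightarrow> complex" where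
  "cross_correlation f h x = (LINT t|lborel. f (t + x) * cnj (h t))"

lemma cross_correlation_eq_L2_inner: "cross_correlation f h x = L2_inner (\<lambda>t. f (t + x)) h"
  by (simp add: cross_correlation_def L2_inner_def)

lemma cross_correlation_shift: "cross_correlation f h x = (LINT t|lborel. f t * cnj (h (t - x)))"
  unfolding cross_correlation_def
  using integral_translate[of "\<lambda>t. f t * cnj (h (t - x))" x] by simp

lemma norm_cross_correlation_le:
  assumes "f \<in> L2" "h \<in> L2" "s > 0"
  shows "norm (cross_correlation f h x)
    \<le> (s * (LINT t|lborel. (cmod (f t))\<^sup>2) + (LINT t|lborel. (cmod (h t))\<^sup>2) / s) / 2"
  using norm_L2_inner_le[OF L2_translate[OF assms(1)] assms(2,3), of x]
    integral_translate[of "\<lambda>t. (cmod (f t))\<^sup>2" x]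
  by (simp add: cross_correlation_eq_L2_inner)

text \<open>
  Moving the shift onto \<open>\<phi>\<close> makes the integrand converge pointwise by continuity. Since the shifts
  \<open>x n\<close> are bounded, the shifted copies of \<open>\<phi>\<close> share a compact support, which provides the
  dominating function.
\<close>

lemma cross_correlation_tendsto_bounded_support:
  assumes f: "f \<in> L2" and K: "K > 0" and cont: "continuous_on UNIV \<phi>"
    and le: "\<And>t. cmod (\<phi> t) \<le> K * indicator {-K..K} t"
    and x: "x \<longlonglongrightarrow> 0"
  shows "(\<lambda>n. cross_correlation f \<phi> (x n)) \<longlonglongrightarrow> cross_correlation f \<phi> 0"
proof -
  note [measurable] = L2_measurable[OF f] borel_measurable_continuous_onI[OF cont]
  obtain B where B: "B > 0" "\<And>n. \<bar>x n\<bar> \<le> B"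
    using convergent_imp_Bseq[OF convergentI[OF x]] by (auto simp: Bseq_def)
  define w where "w t = complex_of_real ((K + B) * indicator {-(K + B)..K + B} t)" for t
  have norm_w: "cmod (w t) = (K + B) * indicator {-(K + B)..K + B} t" for t
    unfolding w_def norm_of_real using K B(1) by (simp add: indicator_def)
  have "w \<in> L2"
    using norm_w by (intro bounded_support_in_L2[of _ "K + B"]) (auto simp: w_def[abs_def])
  then have int: "integrable lborel (\<lambda>t. norm (f t * cnj (w t)))"
    by (intro integrable_norm L2_mult_integrable f)
  have bound: "cmod (\<phi> (t - x n)) \<le> cmod (w t)" for t n
  proof (cases "t - x n \<in> {-K..K}")
    case True
    then have "cmod (\<phi> (t - x n)) \<le> K" using le[of "t - x n"] by simp
    moreover have "t \<in> {-(K + B)..K + B}" using True B(2)[of n] by auto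
    ultimately show ?thesis using B(1) by (simp add: norm_w)
  next
    case False
    then have "cmod (\<phi> (t - x n)) \<le> 0" using le[of "t - x n"] by simp
    then show ?thesis by simp
  qed
  show ?thesis
    unfolding cross_correlation_shift
  proof (rule integral_dominated_convergence[OF _ _ int])
    have "(\<lambda>n. \<phi> (t - x n)) \<longlonglongrightarrow> \<phi> (t - 0)" for t
      using cont by (intro continuous_on_tendsto_compose[OF cont] tendsto_intros x) auto
    then show "AE t in lborel. (\<lambda>n. f t * cnj (\<phi> (t - x n))) \<longlonglongrightarrow> f t * cnj (\<phi> (t - 0))"
      by (intro AE_I2 tendsto_intros)
    show "AE t in lborel. norm (f t * cnj (\<phi> (t - x n))) \<le> norm (f t * cnj (w t))" for n
      using bound[of _ n] by (intro AE_I2) (simp add: norm_mult mult_left_mono)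
  qed measurable
qed

text \<open>
  Continuity of the correlation at \<open>0\<close>: approximating \<open>h\<close> in \<open>L\<^sup>2\<close> by a continuous compactly
  supported function changes the correlation by little, uniformly in the shift.
\<close>

lemma cross_correlation_tendsto:
  assumes f: "f \<in> L2" and h: "h \<in> L2" and x: "x \<longlonglongrightarrow> 0"
  shows "(\<lambda>n. cross_correlation f h (x n)) \<longlonglongrightarrow> cross_correlation f h 0"
proof (rule LIMSEQ_I)
  fix r :: real assume r: "0 < r"
  define N where "N = (LINT t|lborel. (cmod (f t))\<^sup>2)"
  have N: "N \<ge> 0" by (simp add: N_def)
  \<comment> \<open>The weight is fixed before the approximation, so that the accuracy demanded of \<open>\<phi>\<close> may depend
    on it; the \<open>1\<close> guards against \<open>N = 0\<close>.\<close>
  define s where "s = r / 3 / (N + 1)"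
  have s: "s > 0" using r N by (simp add: s_def)
  have sN: "s * N \<le> r / 3" using r N by (simp add: s_def field_simps)
  obtain \<phi> K where K: "K > 0" and cont: "continuous_on UNIV \<phi>" and \<phi>: "\<phi> \<in> L2"
    and le: "\<And>t. cmod (\<phi> t) \<le> K * indicator {-K..K} t"
    and D: "(LINT t|lborel. (cmod (h t - \<phi> t))\<^sup>2) < s * (r / 3)"
    by (rule L2_approx_continuous[OF h, of "s * (r / 3)"]) (use s r in auto)
  have close: "norm (cross_correlation f h y - cross_correlation f \<phi> y) \<le> r / 3" for y
  proof -
    have "cross_correlation f h y - cross_correlation f \<phi> y = cross_correlation f (\<lambda>t. h t - \<phi> t) y"
      unfolding cross_correlation_def
      using L2_mult_integrable[OF L2_translate[OF f, of y] h]
        L2_mult_integrable[OF L2_translate[OF f, of y] \<phi>]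
      by (subst Bochner_Integration.integral_diff[symmetric]) (simp_all add: right_diff_distrib)
    also have "norm \<dots> \<le> (s * N + (LINT t|lborel. (cmod (h t - \<phi> t))\<^sup>2) / s) / 2"
      unfolding N_def by (intro norm_cross_correlation_le f L2_diff h \<phi> s)
    also have "\<dots> \<le> (r / 3 + r / 3) / 2"
      using sN D s by (intro divide_right_mono add_mono) (auto simp: field_simps)
    finally show ?thesis by simp
  qed
  from LIMSEQ_D[OF cross_correlation_tendsto_bounded_support[OF f K cont le x], of "r / 3"] r
  obtain n0 where n0: "\<And>n. n \<ge> n0 \<Longrightarrow>
      norm (cross_correlation f \<phi> (x n) - cross_correlation f \<phi> 0) < r / 3" by auto
  show "\<exists>no. \<forall>n\<ge>no. norm (cross_correlation f h (x n) - cross_correlation f h 0) < r"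
  proof (intro exI allI impI)
    fix n assume n: "n \<ge> n0"
    let ?d = "\<lambda>y. cross_correlation f h y - cross_correlation f \<phi> y"
    let ?e = "cross_correlation f \<phi> (x n) - cross_correlation f \<phi> 0"
    have "norm (?d (x n) + ?e - ?d 0) \<le> norm (?d (x n)) + norm ?e + norm (?d 0)"
      by (rule order_trans[OF norm_triangle_ineq4 add_right_mono[OF norm_triangle_ineq]])
    then have "norm (?d (x n) + ?e - ?d 0) < r"
      using close[of "x n"] close[of 0] n0[OF n] by linarith
    then show "norm (cross_correlation f h (x n) - cross_correlation f h 0) < r"
      by simp
  qed
qed

section \<open>Gaussian regularisation of the Fourier transform\<close>

text \<open>
  The change of variables \<open>(t, x) \<mapsto> (t, r t + s x)\<close> applied to a tensor product. The cases used
  below are \<open>r = 0\<close> (tensor products), \<open>r = s = 1\<close> (correlations) and \<open>r = 1\<close>, \<open>s = -1\<close> (sliding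
  windows).
\<close>

lemma integrable_prod_affine:
  fixes p q :: "real \<Rightarrow> 'a :: {banach, second_countable_topology, real_normed_div_algebra}"
  assumes p: "integrable lborel p" and q: "integrable lborel q" and s: "s \<noteq> 0"
  shows "integrable (lborel \<Otimes>\<^sub>M lborel) (\<lambda>(t, x). p t * q (r * t + s * x))"
proof (rule lborel_pair.Fubini_integrable)
  note [measurable] = borel_measurable_integrable[OF p] borel_measurable_integrable[OF q]
  have qs: "integrable lborel (\<lambda>x. q (y + s * x))" for y
    using q s by (rule lborel_integrable_real_affine)
  show "(\<lambda>(t, x). p t * q (r * t + s * x)) \<in> borel_measurable (lborel \<Otimes>\<^sub>M lborel)"
    by measurable
  have "(LINT x|lborel. norm (q (y + s * x))) = (LINT x|lborel. norm (q x)) / \<bar>s\<bar>" for y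
    using lborel_integral_real_affine[OF s, of "\<lambda>x. norm (q x)" y] s by (simp add: field_simps)
  then show "integrable lborel (\<lambda>t. LINT x|lborel. norm (case (t, x) of (t, x) \<Rightarrow> p t * q (r * t + s * x)))"
    using p by (simp add: norm_mult)
  show "AE t in lborel. integrable lborel (\<lambda>x. case (t, x) of (t, x) \<Rightarrow> p t * q (r * t + s * x))"
    using qs by (intro AE_I2) simp
qed

definition fourier :: "(real \<Rightarrow> complex) \<Rightarrow> real \<Rightarrow> complex" where
  "fourier f \<tau> = (LINT t|lborel. f t * cis (- (\<tau> * t)))"

lemma integrable_mult_cis:
  assumes "integrable M f" and [measurable]: "\<theta> \<in> borel_measurable M"
  shows "integrable M (\<lambda>x. f x * cis (\<theta> x))"
proof -
  note [measurable] = borel_measurable_integrable[OF assms(1)]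
  show ?thesis
    by (rule Bochner_Integration.integrable_bound[OF assms(1)]) (auto simp: norm_mult)
qed

lemma fourier_measurable [measurable]:
  assumes [measurable]: "f \<in> borel_measurable borel"
  shows "fourier f \<in> borel_measurable borel"
  unfolding fourier_def by measurable

lemma norm_fourier_le: "norm (fourier f \<tau>) \<le> (LINT t|lborel. norm (f t))"
  unfolding fourier_def by (rule order_trans[OF integral_norm_bound]) (simp add: norm_mult)

lemma integrable_cross_correlation_kernel:
  fixes f h :: "real \<Rightarrow> complex"
  assumes f: "integrable lborel f" and h: "integrable lborel h"
  shows "integrable (lborel \<Otimes>\<^sub>M lborel) (\<lambda>(t, x). f (t + x) * cnj (h t))"
  using integrable_prod_affine[of "\<lambda>t. cnj (h t)" f 1 1] f h by (simp add: mult.commute)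

lemma integrable_cross_correlation:
  fixes f h :: "real \<Rightarrow> complex"
  assumes "integrable lborel f" "integrable lborel h"
  shows "integrable lborel (cross_correlation f h)"
  using lborel_pair.integrable_snd[OF integrable_cross_correlation_kernel[OF assms]]
  by (simp add: cross_correlation_def[abs_def])

text \<open>
  The correlation is the convolution of \<open>f\<close> with the reflected conjugate of \<open>h\<close>, so its transform
  is a product.
\<close>

lemma fourier_cross_correlation:
  fixes f h :: "real \<Rightarrow> complex"
  assumes f: "integrable lborel f" and h: "integrable lborel h"
  shows "fourier (cross_correlation f h) \<tau> = fourier f \<tau> * cnj (fourier h \<tau>)"
proof -
  have "integrable (lborel \<Otimes>\<^sub>M lborel)
      (\<lambda>p. (case p of (t, x) \<Rightarrow> f (t + x) * cnj (h t)) * cis (- (\<tau> * snd p)))"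
    by (intro integrable_mult_cis integrable_cross_correlation_kernel f h) measurable
  then have int: "integrable (lborel \<Otimes>\<^sub>M lborel) (\<lambda>(t, x). f (t + x) * cnj (h t) * cis (- (\<tau> * x)))"
    by (simp add: case_prod_unfold)
  have "fourier (cross_correlation f h) \<tau>
      = (LINT x|lborel. LINT t|lborel. f (t + x) * cnj (h t) * cis (- (\<tau> * x)))"
    by (simp add: fourier_def cross_correlation_def)
  also have "\<dots> = (LINT t|lborel. LINT x|lborel. f (t + x) * cnj (h t) * cis (- (\<tau> * x)))"
    by (rule lborel_pair.Fubini_integral[OF int])
  also have "\<dots> = (LINT t|lborel. fourier f \<tau> * cnj (h t * cis (- (\<tau> * t))))"
  proof (rule Bochner_Integration.integral_cong[OF refl])
    fix t
    have "f (t + x) * cnj (h t) * cis (- (\<tau> * x))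
        = (f (x + t) * cis (- (\<tau> * (x + t)))) * cnj (h t * cis (- (\<tau> * t)))" for x
      by (simp add: cis_cnj cis_mult algebra_simps)
    then show "(LINT x|lborel. f (t + x) * cnj (h t) * cis (- (\<tau> * x)))
        = fourier f \<tau> * cnj (h t * cis (- (\<tau> * t)))"
      by (simp only: integral_mult_left_zero fourier_def
            integral_translate[of "\<lambda>x. f x * cis (- (\<tau> * x))" t])
  qed
  also have "\<dots> = fourier f \<tau> * cnj (fourier h \<tau>)"
    by (simp only: integral_mult_right_zero Bochner_Integration.integral_cnj fourier_def)
  finally show ?thesis .
qed

lemma fourier_std_normal_density:
  "fourier (\<lambda>t. of_real (std_normal_density t)) x = of_real (sqrt (2 * pi) * std_normal_density x)"
proof -
  have "fourier (\<lambda>t. of_real (std_normal_density t)) x = char std_normal_distribution (- x)"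
    unfolding char_def fourier_def
    by (subst integral_density)
       (auto simp: normal_density_nonneg scaleR_conv_of_real cis_conv_exp)
  also have "\<dots> = of_real (sqrt (2 * pi) * std_normal_density x)"
    unfolding char_std_normal_distribution by (simp add: std_normal_density_def)
  finally show ?thesis .
qed

lemma integrable_std_normal_density: "integrable lborel std_normal_density"
  using integrable_std_normal_moment[of 0] by simp

text \<open>
  Fubini moves the Fourier transform from \<open>f\<close> to the Gaussian, whose transform is again a Gaussian.
  For small \<open>\<sigma>\<close> the left side approximates the integral of the transform of \<open>f\<close>, while the right
  side averages \<open>f\<close> over a small neighbourhood of \<open>0\<close>: a regularised inversion formula at \<open>0\<close>.
\<close>

lemma integral_fourier_gaussian:
  fixes f :: "real \<Rightarrow> complex"
  assumes f: "integrable lborel f" and \<sigma>: "\<sigma> > 0"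
  shows "(LINT \<tau>|lborel. fourier f \<tau> * of_real (exp (- (\<sigma> * \<tau>)\<^sup>2 / 2)))
    = 2 * pi * (LINT z|lborel. of_real (std_normal_density z) * f (\<sigma> * z))"
proof -
  let ?N = "\<lambda>t. complex_of_real (std_normal_density t)"
  have two_pi: "\<bar>2 * pi\<bar> = 2 * pi" by simp
  have N: "integrable lborel ?N" using integrable_std_normal_density by simp
  have "integrable (lborel \<Otimes>\<^sub>M lborel) (\<lambda>(x, \<tau>). f x * ?N (0 * x + \<sigma> * \<tau>))"
    using \<sigma> by (intro integrable_prod_affine f N) simp
  then have "integrable (lborel \<Otimes>\<^sub>M lborel)
      (\<lambda>p. (case p of (x, \<tau>) \<Rightarrow> f x * ?N (\<sigma> * \<tau>)) * cis (- (snd p * fst p)))"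
    by (intro integrable_mult_cis) simp_all
  then have int: "integrable (lborel \<Otimes>\<^sub>M lborel)
      (\<lambda>(x, \<tau>). f x * cis (- (\<tau> * x)) * ?N (\<sigma> * \<tau>))"
    by (simp add: case_prod_unfold mult_ac)
  have N_scaled: "(LINT \<tau>|lborel. ?N (\<sigma> * \<tau>) * cis (- (\<tau> * x)))
      = of_real (sqrt (2 * pi) * std_normal_density (x / \<sigma>)) / \<sigma>" for x
    using lborel_integral_real_affine[of \<sigma> "\<lambda>y. ?N y * cis (- (x / \<sigma> * y))" 0] \<sigma>
      fourier_std_normal_density[of "x / \<sigma>"]
    by (simp add: fourier_def scaleR_conv_of_real field_simps)
  have "(LINT \<tau>|lborel. fourier f \<tau> * ?N (\<sigma> * \<tau>))
      = (LINT \<tau>|lborel. LINT x|lborel. f x * cis (- (\<tau> * x)) * ?N (\<sigma> * \<tau>))"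
    by (simp add: fourier_def)
  also have "\<dots> = (LINT x|lborel. LINT \<tau>|lborel. f x * cis (- (\<tau> * x)) * ?N (\<sigma> * \<tau>))"
    by (rule lborel_pair.Fubini_integral[OF int])
  also have "\<dots> = (LINT x|lborel. f x * (LINT \<tau>|lborel. ?N (\<sigma> * \<tau>) * cis (- (\<tau> * x))))"
    by (simp add: mult_ac flip: integral_mult_right_zero)
  also have "\<dots> = (LINT x|lborel. (?N (x / \<sigma>) * f x) * (of_real (sqrt (2 * pi)) / of_real \<sigma>))"
    unfolding N_scaled by (simp add: mult_ac)
  also have "\<dots> = sqrt (2 * pi) * (LINT z|lborel. ?N z * f (\<sigma> * z))"
    using lborel_integral_real_affine[of \<sigma> "\<lambda>x. ?N (x / \<sigma>) * f x" 0] \<sigma>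
    by (simp add: scaleR_conv_of_real)
  finally have *: "(LINT \<tau>|lborel. fourier f \<tau> * ?N (\<sigma> * \<tau>))
      = sqrt (2 * pi) * (LINT z|lborel. ?N z * f (\<sigma> * z))" .
  have "complex_of_real (exp (- (\<sigma> * \<tau>)\<^sup>2 / 2)) = sqrt (2 * pi) * ?N (\<sigma> * \<tau>)" for \<tau>
    by (simp add: std_normal_density_def)
  then have "(LINT \<tau>|lborel. fourier f \<tau> * of_real (exp (- (\<sigma> * \<tau>)\<^sup>2 / 2)))
      = sqrt (2 * pi) * (LINT \<tau>|lborel. fourier f \<tau> * ?N (\<sigma> * \<tau>))"
    by (simp add: mult_ac flip: integral_mult_right_zero)
  also have "\<dots> = of_real (sqrt (2 * pi) * sqrt (2 * pi)) * (LINT z|lborel. ?N z * f (\<sigma> * z))"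
    by (simp only: * of_real_mult mult.assoc)
  finally show ?thesis by (simp only: real_sqrt_mult_self abs_of_pos two_pi)
qed

section \<open>The identities of Plancherel and Parseval\<close>

text \<open>
  The regularised inversion formula, applied to the cross correlation: its transform is
  \<open>fourier f * cnj (fourier h)\<close>, and its value at \<open>0\<close> is the inner product. The Gaussian averages of
  the correlation converge to that value because it is bounded and continuous at \<open>0\<close>.
\<close>

lemma fourier_product_gaussian_tendsto:
  assumes f: "f \<in> L2" "integrable lborel f" and h: "h \<in> L2" "integrable lborel h"
  shows "(\<lambda>n. LINT \<tau>|lborel. fourier f \<tau> * cnj (fourier h \<tau>) *
            of_real (exp (- (1 / real (Suc n) * \<tau>)\<^sup>2 / 2)))
    \<longlonglongrightarrow> 2 * pi * L2_inner f h"
proof -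
  let ?A = "cross_correlation f h" and ?N = "\<lambda>z. complex_of_real (std_normal_density z)"
  note [measurable] = borel_measurable_integrable[OF integrable_cross_correlation[OF f(2) h(2)]]
  define C where "C = ((LINT t|lborel. (cmod (f t))\<^sup>2) + (LINT t|lborel. (cmod (h t))\<^sup>2)) / 2"
  have C: "norm (?A x) \<le> C" for x
    using norm_cross_correlation_le[OF f(1) h(1), of 1 x] by (simp add: C_def)
  have "(\<lambda>n. LINT z|lborel. ?N z * ?A (1 / real (Suc n) * z)) \<longlonglongrightarrow> (LINT z|lborel. ?N z * ?A 0)"
  proof (rule integral_dominated_convergence[where w = "\<lambda>z. std_normal_density z * C"])
    show "integrable lborel (\<lambda>z. std_normal_density z * C)"
      using integrable_std_normal_density by simp
    have "(\<lambda>n. 1 / real (Suc n) * z) \<longlonglongrightarrow> 0 * z" for z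
      using LIMSEQ_Suc[OF lim_const_over_n[of 1]] by (intro tendsto_intros) simp
    then show "AE z in lborel. (\<lambda>n. ?N z * ?A (1 / real (Suc n) * z)) \<longlonglongrightarrow> ?N z * ?A 0"
      by (intro AE_I2 tendsto_intros cross_correlation_tendsto f h) simp
    show "AE z in lborel. norm (?N z * ?A (1 / real (Suc n) * z)) \<le> std_normal_density z * C" for n
      by (intro AE_I2) (simp add: norm_mult mult_left_mono[OF C] normal_density_nonneg del: of_nat_Suc)
  qed measurable
  moreover have "(LINT z|lborel. ?N z * ?A 0) = L2_inner f h"
    by (simp add: cross_correlation_def L2_inner_def)
  ultimately have "(\<lambda>n. 2 * pi * (LINT z|lborel. ?N z * ?A (1 / real (Suc n) * z)))
      \<longlonglongrightarrow> 2 * pi * L2_inner f h"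
    by (intro tendsto_intros) simp
  then show ?thesis
    unfolding fourier_cross_correlation[OF f(2) h(2), symmetric]
    by (subst integral_fourier_gaussian[OF integrable_cross_correlation[OF f(2) h(2)]]) simp_all
qed

text \<open>
  For \<open>h = f\<close> the regularised integrands are nonnegative and increase with \<open>n\<close>, so monotone
  convergence gives the integrability of the limit together with the value of its integral.
\<close>

lemma Plancherel:
  assumes f: "f \<in> L2" "integrable lborel f"
  shows "integrable lborel (\<lambda>\<tau>. (cmod (fourier f \<tau>))\<^sup>2)"
    and "(LINT \<tau>|lborel. (cmod (fourier f \<tau>))\<^sup>2) = 2 * pi * (LINT t|lborel. (cmod (f t))\<^sup>2)"
proof -
  note [measurable] = L2_measurable[OF f(1)]
  let ?u = "\<lambda>n \<tau>. (cmod (fourier f \<tau>))\<^sup>2 * exp (- (1 / real (Suc n) * \<tau>)\<^sup>2 / 2)"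
  define C where "C = (LINT t|lborel. norm (f t))"
  have int: "integrable lborel (?u n)" for n
  proof (rule Bochner_Integration.integrable_bound)
    have "integrable lborel (\<lambda>\<tau>. std_normal_density (0 + 1 / real (Suc n) * \<tau>))"
      by (rule lborel_integrable_real_affine[OF integrable_std_normal_density]) simp
    then show "integrable lborel
        (\<lambda>\<tau>. C\<^sup>2 * (sqrt (2 * pi) * std_normal_density (0 + 1 / real (Suc n) * \<tau>)))"
      by (intro integrable_mult_right)
    have "(cmod (fourier f \<tau>))\<^sup>2 \<le> C\<^sup>2" for \<tau>
      unfolding C_def by (intro power_mono norm_fourier_le) simp
    then show "AE \<tau> in lborel. norm (?u n \<tau>)
        \<le> norm (C\<^sup>2 * (sqrt (2 * pi) * std_normal_density (0 + 1 / real (Suc n) * \<tau>)))"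
      by (intro AE_I2) (simp add: std_normal_density_def abs_mult mult_right_mono del: of_nat_Suc)
  qed measurable
  have mono: "mono (\<lambda>n. ?u n \<tau>)" for \<tau>
  proof (intro monoI mult_left_mono)
    fix m n :: nat assume "m \<le> n"
    then have "(1 / real (Suc n) * \<tau>)\<^sup>2 \<le> (1 / real (Suc m) * \<tau>)\<^sup>2"
      unfolding power_mult_distrib by (intro mult_right_mono power_mono frac_le) auto
    then show "exp (- (1 / real (Suc m) * \<tau>)\<^sup>2 / 2) \<le> exp (- (1 / real (Suc n) * \<tau>)\<^sup>2 / 2)"
      by (simp del: of_nat_Suc)
  qed simp
  have lim: "(\<lambda>n. ?u n \<tau>) \<longlonglongrightarrow> (cmod (fourier f \<tau>))\<^sup>2" for \<tau>
  proof -
    have "(\<lambda>n. ?u n \<tau>) \<longlonglongrightarrow> (cmod (fourier f \<tau>))\<^sup>2 * exp (- (0 * \<tau>)\<^sup>2 / 2)"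
      using LIMSEQ_Suc[OF lim_const_over_n[of 1]] by (intro tendsto_intros) simp_all
    then show ?thesis by simp
  qed
  have "(\<lambda>n. LINT \<tau>|lborel. complex_of_real (?u n \<tau>)) \<longlonglongrightarrow> 2 * pi * L2_inner f f"
    using fourier_product_gaussian_tendsto[OF f f]
    by (simp only: complex_norm_square of_real_mult)
  also have "2 * pi * L2_inner f f = of_real (2 * pi * (LINT t|lborel. (cmod (f t))\<^sup>2))"
    unfolding L2_inner_def complex_norm_square[symmetric] integral_complex_of_real by simp
  finally have ilim: "(\<lambda>n. LINT \<tau>|lborel. ?u n \<tau>) \<longlonglongrightarrow> 2 * pi * (LINT t|lborel. (cmod (f t))\<^sup>2)"
    unfolding integral_complex_of_real tendsto_of_real_iff .
  show "integrable lborel (\<lambda>\<tau>. (cmod (fourier f \<tau>))\<^sup>2)"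
    by (rule integrable_monotone_convergence[OF int _ _ ilim]) (use mono lim in auto)
  show "(LINT \<tau>|lborel. (cmod (fourier f \<tau>))\<^sup>2) = 2 * pi * (LINT t|lborel. (cmod (f t))\<^sup>2)"
    by (rule integral_monotone_convergence[OF int _ _ ilim]) (use mono lim in auto)
qed

text \<open>
  Once both transforms are known to be square integrable, the Gaussian factor can be removed by
  dominated convergence.
\<close>

lemma Parseval:
  assumes f: "f \<in> L2" "integrable lborel f" and h: "h \<in> L2" "integrable lborel h"
  shows "(LINT \<tau>|lborel. fourier f \<tau> * cnj (fourier h \<tau>)) = 2 * pi * L2_inner f h"
proof (rule LIMSEQ_unique[OF _ fourier_product_gaussian_tendsto[OF f h]])
  note [measurable] = L2_measurable[OF f(1)] L2_measurable[OF h(1)]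
  show "(\<lambda>n. LINT \<tau>|lborel. fourier f \<tau> * cnj (fourier h \<tau>) *
            of_real (exp (- (1 / real (Suc n) * \<tau>)\<^sup>2 / 2)))
      \<longlonglongrightarrow> (LINT \<tau>|lborel. fourier f \<tau> * cnj (fourier h \<tau>))"
  proof (rule integral_dominated_convergence)
    show "integrable lborel (\<lambda>\<tau>. norm (fourier f \<tau> * cnj (fourier h \<tau>)))"
      by (intro integrable_norm integrable_mult_cnj Plancherel f h) measurable
    have "(\<lambda>n. fourier f \<tau> * cnj (fourier h \<tau>) * of_real (exp (- (1 / real (Suc n) * \<tau>)\<^sup>2 / 2)))
        \<longlonglongrightarrow> fourier f \<tau> * cnj (fourier h \<tau>) * of_real (exp (- (0 * \<tau>)\<^sup>2 / 2))" for \<tau>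
      using LIMSEQ_Suc[OF lim_const_over_n[of 1]] by (intro tendsto_intros) simp_all
    then show "AE \<tau> in lborel. (\<lambda>n. fourier f \<tau> * cnj (fourier h \<tau>) *
            of_real (exp (- (1 / real (Suc n) * \<tau>)\<^sup>2 / 2)))
        \<longlonglongrightarrow> fourier f \<tau> * cnj (fourier h \<tau>)"
      by simp
    show "AE \<tau> in lborel. norm (fourier f \<tau> * cnj (fourier h \<tau>) *
            of_real (exp (- (1 / real (Suc n) * \<tau>)\<^sup>2 / 2)))
        \<le> norm (fourier f \<tau> * cnj (fourier h \<tau>))" for n
      by (intro AE_I2) (simp add: norm_mult mult_left_le del: of_nat_Suc)
  qed measurable
qed

section \<open>Partial Fourier transforms in the plane\<close>

lemma fourier_fibre_measurable:
  assumes [measurable]: "P \<in> borel_measurable (lborel \<Otimes>\<^sub>M lborel)"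
  shows "(\<lambda>(u, \<tau>). fourier (\<lambda>t. P (u, t)) \<tau>) \<in> borel_measurable (lborel \<Otimes>\<^sub>M lborel)"
  unfolding fourier_def by measurable

text \<open>
  A square integrable function of two variables has square integrable fibres only for almost every
  \<open>u\<close>, and the Plancherel identity holds for those. This suffices, since a null set
  of fibres does not affect the double integral.
\<close>

lemma integrable_fourier_fibre:
  fixes P :: "real \<times> real \<Rightarrow> complex"
  assumes P [measurable]: "P \<in> borel_measurable (lborel \<Otimes>\<^sub>M lborel)"
    and sq: "integrable (lborel \<Otimes>\<^sub>M lborel) (\<lambda>p. (cmod (P p))\<^sup>2)"
    and fib: "\<And>u. integrable lborel (\<lambda>t. P (u, t))"
  shows "integrable (lborel \<Otimes>\<^sub>M lborel) (\<lambda>(u, \<tau>). (cmod (fourier (\<lambda>t. P (u, t)) \<tau>))\<^sup>2)"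
proof (rule lborel_pair.Fubini_integrable)
  note [measurable] = fourier_fibre_measurable[OF P]
  have ae: "AE u in lborel. (\<lambda>t. P (u, t)) \<in> L2"
    using lborel_pair.AE_integrable_fst'[OF sq] by eventually_elim (intro L2_I, auto)
  show "(\<lambda>(u, \<tau>). (cmod (fourier (\<lambda>t. P (u, t)) \<tau>))\<^sup>2) \<in> borel_measurable (lborel \<Otimes>\<^sub>M lborel)"
    by measurable
  have "integrable lborel (\<lambda>u. LINT \<tau>|lborel. (cmod (fourier (\<lambda>t. P (u, t)) \<tau>))\<^sup>2)
      \<longleftrightarrow> integrable lborel (\<lambda>u. 2 * pi * (LINT t|lborel. (cmod (P (u, t)))\<^sup>2))"
  proof (rule integrable_cong_AE)
    show "AE u in lborel. (LINT \<tau>|lborel. (cmod (fourier (\<lambda>t. P (u, t)) \<tau>))\<^sup>2)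
        = 2 * pi * (LINT t|lborel. (cmod (P (u, t)))\<^sup>2)"
      using ae by eventually_elim (rule Plancherel(2)[OF _ fib])
  qed measurable
  then show "integrable lborel (\<lambda>u. LINT \<tau>|lborel.
      norm (case (u, \<tau>) of (u, \<tau>) \<Rightarrow> (cmod (fourier (\<lambda>t. P (u, t)) \<tau>))\<^sup>2))"
    using lborel_pair.integrable_fst'[OF sq] by simp
  show "AE u in lborel. integrable lborel
      (\<lambda>\<tau>. case (u, \<tau>) of (u, \<tau>) \<Rightarrow> (cmod (fourier (\<lambda>t. P (u, t)) \<tau>))\<^sup>2)"
    using ae by eventually_elim (simp add: Plancherel(1)[OF _ fib])
qed

lemma Parseval_fibre:
  fixes P Q :: "real \<times> real \<Rightarrow> complex"
  assumes P [measurable]: "P \<in> borel_measurable (lborel \<Otimes>\<^sub>M lborel)"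
    and Psq: "integrable (lborel \<Otimes>\<^sub>M lborel) (\<lambda>p. (cmod (P p))\<^sup>2)"
    and Pfib: "\<And>u. integrable lborel (\<lambda>t. P (u, t))"
    and Q [measurable]: "Q \<in> borel_measurable (lborel \<Otimes>\<^sub>M lborel)"
    and Qsq: "integrable (lborel \<Otimes>\<^sub>M lborel) (\<lambda>p. (cmod (Q p))\<^sup>2)"
    and Qfib: "\<And>u. integrable lborel (\<lambda>t. Q (u, t))"
  shows "integrable (lborel \<Otimes>\<^sub>M lborel)
      (\<lambda>(u, \<tau>). fourier (\<lambda>t. P (u, t)) \<tau> * cnj (fourier (\<lambda>t. Q (u, t)) \<tau>))" (is ?int)
    and "(LINT (u, \<tau>)|(lborel \<Otimes>\<^sub>M lborel). fourier (\<lambda>t. P (u, t)) \<tau> * cnj (fourier (\<lambda>t. Q (u, t)) \<tau>))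
      = 2 * pi * (LINT p|(lborel \<Otimes>\<^sub>M lborel). P p * cnj (Q p))"
proof -
  note [measurable] = fourier_fibre_measurable[OF P] fourier_fibre_measurable[OF Q]
  show int: ?int
    using integrable_mult_cnj[OF fourier_fibre_measurable[OF P] fourier_fibre_measurable[OF Q]]
      integrable_fourier_fibre[OF P Psq Pfib] integrable_fourier_fibre[OF Q Qsq Qfib]
    by (simp add: case_prod_unfold)
  have PQ: "integrable (lborel \<Otimes>\<^sub>M lborel) (\<lambda>p. P p * cnj (Q p))"
    by (intro integrable_mult_cnj Psq Qsq) measurable
  have "AE u in lborel. (\<lambda>t. P (u, t)) \<in> L2"
    using lborel_pair.AE_integrable_fst'[OF Psq] by eventually_elim (intro L2_I, auto)
  moreover have "AE u in lborel. (\<lambda>t. Q (u, t)) \<in> L2"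
    using lborel_pair.AE_integrable_fst'[OF Qsq] by eventually_elim (intro L2_I, auto)
  ultimately have ae: "AE u in lborel.
      (LINT \<tau>|lborel. fourier (\<lambda>t. P (u, t)) \<tau> * cnj (fourier (\<lambda>t. Q (u, t)) \<tau>))
        = 2 * pi * (LINT t|lborel. P (u, t) * cnj (Q (u, t)))"
    by eventually_elim (simp add: Parseval Pfib Qfib L2_inner_def)
  have "(LINT (u, \<tau>)|(lborel \<Otimes>\<^sub>M lborel). fourier (\<lambda>t. P (u, t)) \<tau> * cnj (fourier (\<lambda>t. Q (u, t)) \<tau>))
      = (LINT u|lborel. LINT \<tau>|lborel. fourier (\<lambda>t. P (u, t)) \<tau> * cnj (fourier (\<lambda>t. Q (u, t)) \<tau>))"
    by (rule lborel_pair.integral_fst[OF int, symmetric])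
  also have "\<dots> = (LINT u|lborel. 2 * pi * (LINT t|lborel. P (u, t) * cnj (Q (u, t))))"
    using ae by (intro integral_cong_AE) measurable
  also have "\<dots> = 2 * pi * (LINT p|(lborel \<Otimes>\<^sub>M lborel). P p * cnj (Q p))"
    by (simp add: lborel_pair.integral_fst'[OF PQ])
  finally show "(LINT (u, \<tau>)|(lborel \<Otimes>\<^sub>M lborel). fourier (\<lambda>t. P (u, t)) \<tau> * cnj (fourier (\<lambda>t. Q (u, t)) \<tau>))
      = 2 * pi * (LINT p|(lborel \<Otimes>\<^sub>M lborel). P p * cnj (Q p))" .
qed

section \<open>Orthogonality of windowed transforms\<close>

text \<open>
  The integrand of a short-time transform, without the oscillating factor. The phase \<open>\<theta>\<close>
  stands for the chirp of the offset linear canonical transform; keeping it abstract shows that the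
  orthogonality relation below is that of the short-time Fourier transform (\<open>\<theta> = 0\<close>).
\<close>

definition windowed :: "(real \<times> real \<Rightarrow> real) \<Rightarrow> (real \<Rightarrow> complex) \<Rightarrow> (real \<Rightarrow> complex) \<Rightarrow>
    real \<times> real \<Rightarrow> complex" where
  "windowed \<theta> g f = (\<lambda>(u, t). f t * cnj (g (t - u)) * cis (- \<theta> (u, t)))"

lemma windowed_measurable:
  assumes [measurable]: "\<theta> \<in> borel_measurable (lborel \<Otimes>\<^sub>M lborel)"
    "g \<in> borel_measurable borel" "f \<in> borel_measurable borel"
  shows "windowed \<theta> g f \<in> borel_measurable (lborel \<Otimes>\<^sub>M lborel)"
  unfolding windowed_def by measurable

lemma integrable_windowed_fibre:
  assumes [measurable]: "\<theta> \<in> borel_measurable (lborel \<Otimes>\<^sub>M lborel)"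
    and g: "g \<in> L2" and f: "f \<in> L2"
  shows "integrable lborel (\<lambda>t. windowed \<theta> g f (u, t))"
proof -
  have "integrable lborel (\<lambda>t. f t * cnj (g (t - u)))"
    using L2_mult_integrable[OF f L2_translate[OF g, of "- u"]] by simp
  then have "integrable lborel (\<lambda>t. f t * cnj (g (t - u)) * cis (- \<theta> (u, t)))"
    by (rule integrable_mult_cis) measurable
  then show ?thesis by (simp add: windowed_def)
qed

lemma integrable_swapped_difference:
  fixes p q :: "real \<Rightarrow> 'a :: {banach, second_countable_topology, real_normed_div_algebra}"
  assumes "integrable lborel p" "integrable lborel q"
  shows "integrable (lborel \<Otimes>\<^sub>M lborel) (\<lambda>(u, t). p t * q (t - u))"
proof -
  have "integrable (lborel \<Otimes>\<^sub>M lborel) (\<lambda>(t, u). p t * q (1 * t + (-1) * u))"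
    by (intro integrable_prod_affine assms) simp
  from lborel_pair.integrable_product_swap[OF this] show ?thesis by simp
qed

lemma integrable_windowed_power2:
  assumes "g \<in> L2" "f \<in> L2"
  shows "integrable (lborel \<Otimes>\<^sub>M lborel) (\<lambda>p. (cmod (windowed \<theta> g f p))\<^sup>2)"
  using integrable_swapped_difference[OF L2_integrable_power2[OF assms(2)] L2_integrable_power2[OF assms(1)]]
  by (simp add: windowed_def case_prod_unfold norm_mult power_mult_distrib)

text \<open>
  The phases cancel and the integrand factors as \<open>f(t) cnj(h(t))\<close> times a function of \<open>t - u\<close>;
  integrating over \<open>u\<close> first turns the second factor into the constant \<open>\<langle>g\<^sub>2, g\<^sub>1\<rangle>\<close>.
\<close>

lemma integral_windowed_product:
  assumes f: "f \<in> L2" and h: "h \<in> L2" and g\<^sub>1: "g\<^sub>1 \<in> L2" and g\<^sub>2: "g\<^sub>2 \<in> L2"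
  shows "(LINT p|(lborel \<Otimes>\<^sub>M lborel). windowed \<theta> g\<^sub>1 f p * cnj (windowed \<theta> g\<^sub>2 h p))
    = L2_inner f h * L2_inner g\<^sub>2 g\<^sub>1"
proof -
  let ?q = "\<lambda>x. g\<^sub>2 x * cnj (g\<^sub>1 x)"
  have cis: "cis (- x) * cnj (cis (- x)) = 1" for x
    by (simp add: cis_cnj cis_mult)
  have "windowed \<theta> g\<^sub>1 f p * cnj (windowed \<theta> g\<^sub>2 h p)
      = (case p of (u, t) \<Rightarrow> (f t * cnj (h t)) * ?q (t - u))" for p
  proof -
    obtain u t where p: "p = (u, t)" by (cases p)
    have "windowed \<theta> g\<^sub>1 f p * cnj (windowed \<theta> g\<^sub>2 h p)
        = (f t * cnj (h t)) * ?q (t - u) * (cis (- \<theta> p) * cnj (cis (- \<theta> p)))"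
      unfolding windowed_def p by (simp only: prod.case complex_cnj_mult complex_cnj_cnj mult_ac)
    then show ?thesis by (simp only: cis p prod.case mult_1_right)
  qed
  then have "(LINT p|(lborel \<Otimes>\<^sub>M lborel). windowed \<theta> g\<^sub>1 f p * cnj (windowed \<theta> g\<^sub>2 h p))
      = (LINT (u, t)|(lborel \<Otimes>\<^sub>M lborel). (f t * cnj (h t)) * ?q (t - u))"
    by simp
  also have "\<dots> = (LINT t|lborel. LINT u|lborel. (f t * cnj (h t)) * ?q (t - u))"
    by (intro lborel_pair.integral_snd[symmetric] integrable_swapped_difference L2_mult_integrable f h g\<^sub>1 g\<^sub>2)
  also have "\<dots> = (LINT t|lborel. (f t * cnj (h t)) * L2_inner g\<^sub>2 g\<^sub>1)"
  proof (rule Bochner_Integration.integral_cong[OF refl])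
    fix t
    have "(LINT u|lborel. ?q (t - u)) = L2_inner g\<^sub>2 g\<^sub>1"
      using lborel_integral_real_affine[of "-1" ?q t] by (simp add: L2_inner_def)
    then show "(LINT u|lborel. (f t * cnj (h t)) * ?q (t - u)) = (f t * cnj (h t)) * L2_inner g\<^sub>2 g\<^sub>1"
      by (simp only: integral_mult_right_zero)
  qed
  also have "\<dots> = L2_inner f h * L2_inner g\<^sub>2 g\<^sub>1"
    by (simp only: integral_mult_left_zero L2_inner_def)
  finally show ?thesis .
qed

text \<open>
  Parseval on the fibres over \<open>u\<close> removes both Fourier transforms and leaves the integral of the
  product of the two windowed functions, which factors. For \<open>\<theta> = 0\<close> this is Moyal's identity.
\<close>

lemma windowed_fourier_orthogonality:
  assumes \<theta>: "\<theta> \<in> borel_measurable (lborel \<Otimes>\<^sub>M lborel)"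
    and f: "f \<in> L2" and h: "h \<in> L2" and g\<^sub>1: "g\<^sub>1 \<in> L2" and g\<^sub>2: "g\<^sub>2 \<in> L2"
  shows "integrable lborel (\<lambda>(u, \<tau>). fourier (\<lambda>t. windowed \<theta> g\<^sub>1 f (u, t)) \<tau> *
            cnj (fourier (\<lambda>t. windowed \<theta> g\<^sub>2 h (u, t)) \<tau>))"
    and "(LINT (u, \<tau>)|lborel. fourier (\<lambda>t. windowed \<theta> g\<^sub>1 f (u, t)) \<tau> *
            cnj (fourier (\<lambda>t. windowed \<theta> g\<^sub>2 h (u, t)) \<tau>))
      = 2 * pi * (L2_inner f h * L2_inner g\<^sub>2 g\<^sub>1)"
proof -
  note facts = windowed_measurable[OF \<theta> L2_measurable[OF g\<^sub>1] L2_measurable[OF f]]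
    integrable_windowed_power2[OF g\<^sub>1 f] integrable_windowed_fibre[OF \<theta> g\<^sub>1 f]
    windowed_measurable[OF \<theta> L2_measurable[OF g\<^sub>2] L2_measurable[OF h]]
    integrable_windowed_power2[OF g\<^sub>2 h] integrable_windowed_fibre[OF \<theta> g\<^sub>2 h]
  show "integrable lborel (\<lambda>(u, \<tau>). fourier (\<lambda>t. windowed \<theta> g\<^sub>1 f (u, t)) \<tau> *
            cnj (fourier (\<lambda>t. windowed \<theta> g\<^sub>2 h (u, t)) \<tau>))"
    using Parseval_fibre(1)[OF facts] unfolding lborel_prod .
  show "(LINT (u, \<tau>)|lborel. fourier (\<lambda>t. windowed \<theta> g\<^sub>1 f (u, t)) \<tau> *
            cnj (fourier (\<lambda>t. windowed \<theta> g\<^sub>2 h (u, t)) \<tau>))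
      = 2 * pi * (L2_inner f h * L2_inner g\<^sub>2 g\<^sub>1)"
    using Parseval_fibre(2)[OF facts] unfolding lborel_prod integral_windowed_product[OF f h g\<^sub>1 g\<^sub>2, unfolded lborel_prod] .
qed

section \<open>Inversion of the offset linear canonical transform\<close>

lemma L2_inner_cnj: "L2_inner h f = cnj (L2_inner f h)"
  unfolding L2_inner_def Bochner_Integration.integral_cnj[symmetric] by (simp add: mult.commute)

lemma L2_inner_scale_left: "L2_inner (\<lambda>t. k * f t) h = k * L2_inner f h"
  unfolding L2_inner_def by (simp add: mult.assoc)

lemma L2_scale:
  assumes "f \<in> L2"
  shows "(\<lambda>t. k * f t) \<in> L2"
proof (rule L2_I)
  note [measurable] = L2_measurable[OF assms]
  show "(\<lambda>t. k * f t) \<in> borel_measurable borel" by measurable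
  show "integrable lborel (\<lambda>t. (cmod (k * f t))\<^sup>2)"
    using L2_integrable_power2[OF assms] by (simp add: norm_mult power_mult_distrib)
qed

definition chirp :: "olct_params \<Rightarrow> real \<times> real \<Rightarrow> real" where
  "chirp M = (case M of (a, b, c, d, u\<^sub>0, \<omega>\<^sub>0) \<Rightarrow> \<lambda>(u, t). a * t / b * (u - t) - d * u\<^sub>0\<^sup>2 / (2 * b))"

lemma chirp_measurable: "chirp M \<in> borel_measurable (lborel \<Otimes>\<^sub>M lborel)"
  unfolding chirp_def by (cases M) (simp add: case_prod_unfold)

lemma window_atom_eq: "window_atom M g u \<tau> t = g (t - u) * cis (chirp M (u, t)) * cis (\<tau> * t)"
  by (cases M) (simp add: chirp_def cis_conv_exp exp_add[symmetric] exp_diff algebra_simps)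

lemma window_atom_in_L2:
  assumes g: "g \<in> L2"
  shows "window_atom M g u \<tau> \<in> L2"
proof (rule L2_I)
  note [measurable] = L2_measurable[OF g] chirp_measurable[of M]
  show "window_atom M g u \<tau> \<in> borel_measurable borel"
    unfolding window_atom_eq[abs_def] by measurable
  show "integrable lborel (\<lambda>t. (cmod (window_atom M g u \<tau> t))\<^sup>2)"
    using L2_integrable_power2[OF L2_translate[OF g, of "- u"]]
    by (simp add: window_atom_eq norm_mult)
qed

lemma L2_inner_window_atom:
  "L2_inner f (window_atom M g u \<tau>) = fourier (\<lambda>t. windowed (chirp M) g f (u, t)) \<tau>"
  by (simp add: L2_inner_def fourier_def windowed_def window_atom_eq cis_cnj mult_ac)

lemma stolct_eq_fourier:
  "stolct (a, b, c, d, u\<^sub>0, \<omega>\<^sub>0) g f u \<tau> = 1 / csqrt (2 * of_real pi * \<i> * of_real b) *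
    fourier (\<lambda>t. windowed (chirp (a, b, c, d, u\<^sub>0, \<omega>\<^sub>0)) g f (u, t)) \<tau>"
  by (simp only: stolct.simps L2_inner_window_atom)

text \<open>
  Pairing the atom with \<open>h\<close> gives the conjugate of the transform of \<open>h\<close> with window \<open>g\<^sub>2\<close>, so the weak
  synthesis integral is the scalar product of two short-time transforms, which the orthogonality
  relation evaluates.
\<close>

lemma stolct_synthesis:
  assumes f: "f \<in> L2" and g\<^sub>1: "g\<^sub>1 \<in> L2" and g\<^sub>2: "g\<^sub>2 \<in> L2"
  shows "has_weak_L2_integral lborel
    (\<lambda>(u, \<tau>) t. stolct (a, b, c, d, u\<^sub>0, \<omega>\<^sub>0) g\<^sub>1 f u \<tau> *
                 window_atom (a, b, c, d, u\<^sub>0, \<omega>\<^sub>0) g\<^sub>2 u \<tau> t)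
    (\<lambda>t. 2 * pi * L2_inner g\<^sub>2 g\<^sub>1 / csqrt (2 * of_real pi * \<i> * of_real b) * f t)"
proof -
  let ?M = "(a, b, c, d, u\<^sub>0, \<omega>\<^sub>0)"
  let ?s = "csqrt (2 * of_real pi * \<i> * of_real b)"
  let ?\<Phi> = "\<lambda>(u, \<tau>) t. stolct ?M g\<^sub>1 f u \<tau> * window_atom ?M g\<^sub>2 u \<tau> t"
  let ?V = "\<lambda>g f (u, \<tau>). fourier (\<lambda>t. windowed (chirp ?M) g f (u, t)) \<tau>"
  have inner: "L2_inner (?\<Phi> p) h
      = 1 / ?s * (case p of (u, \<tau>) \<Rightarrow> ?V g\<^sub>1 f (u, \<tau>) * cnj (?V g\<^sub>2 h (u, \<tau>)))" for p h
  proof -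
    obtain u \<tau> where p: "p = (u, \<tau>)" by (cases p)
    have "L2_inner (window_atom ?M g\<^sub>2 u \<tau>) h = cnj (?V g\<^sub>2 h (u, \<tau>))"
      by (subst L2_inner_cnj) (simp add: L2_inner_window_atom)
    then show ?thesis
      unfolding p prod.case L2_inner_scale_left stolct_eq_fourier by (simp only: mult.assoc)
  qed
  show ?thesis
    unfolding has_weak_L2_integral_def
  proof (intro conjI ballI allI)
    show "(\<lambda>t. 2 * pi * L2_inner g\<^sub>2 g\<^sub>1 / ?s * f t) \<in> L2"
      by (rule L2_scale[OF f])
    show "?\<Phi> p \<in> L2" for p
      unfolding case_prod_beta by (rule L2_scale[OF window_atom_in_L2[OF g\<^sub>2]])
    fix h assume h: "h \<in> L2"
    note orth = windowed_fourier_orthogonality[OF chirp_measurable f h g\<^sub>1 g\<^sub>2, of ?M]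
    show "integrable lborel (\<lambda>p. L2_inner (?\<Phi> p) h)"
      unfolding inner using orth(1) by (intro integrable_mult_right) simp
    have "(LINT p|lborel. L2_inner (?\<Phi> p) h) = 1 / ?s * (2 * pi * (L2_inner f h * L2_inner g\<^sub>2 g\<^sub>1))"
      unfolding inner integral_mult_right_zero using orth(2) by simp
    also have "\<dots> = 2 * pi * L2_inner g\<^sub>2 g\<^sub>1 / ?s * L2_inner f h"
      by simp
    finally show "L2_inner (\<lambda>t. 2 * pi * L2_inner g\<^sub>2 g\<^sub>1 / ?s * f t) h = (LINT p|lborel. L2_inner (?\<Phi> p) h)"
      unfolding L2_inner_scale_left by (rule sym)
  qed
qed

lemma csqrt_mult_cnj: "csqrt z * cnj (csqrt z) = of_real (cmod z)"
proof -
  have "csqrt z * cnj (csqrt z) = of_real ((cmod (csqrt z))\<^sup>2)"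
    by (simp only: complex_norm_square)
  also have "(cmod (csqrt z))\<^sup>2 = cmod z"
    by (simp flip: norm_power)
  finally show ?thesis .
qed

theorem theorem3p9:
  fixes a b c d u\<^sub>0 \<omega>\<^sub>0 :: real
    and f\<^sub>1 g\<^sub>1 g\<^sub>2 :: "real \<Rightarrow> complex"
  assumes "a * d - b * c = 1" and "b \<noteq> 0"
    and "f\<^sub>1 \<in> L2" and "g\<^sub>1 \<in> L2" and "g\<^sub>2 \<in> L2"
    and "L2_inner g\<^sub>2 g\<^sub>1 \<noteq> 0"
  shows "\<exists>F. has_weak_L2_integral (lborel :: (real \<times> real) measure)
               (\<lambda>(u, \<tau>) t. stolct (a, b, c, d, u\<^sub>0, \<omega>\<^sub>0) g\<^sub>1 f\<^sub>1 u \<tau> *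
                            window_atom (a, b, c, d, u\<^sub>0, \<omega>\<^sub>0) g\<^sub>2 u \<tau> t) F \<and>
             (AE t in lborel. f\<^sub>1 t =
                of_real \<bar>b\<bar> / (cnj (csqrt (2 * of_real pi * of_real b * \<i>)) * L2_inner g\<^sub>2 g\<^sub>1) * F t)"
proof (intro exI conjI)
  let ?s = "csqrt (2 * of_real pi * \<i> * of_real b)"
  show "has_weak_L2_integral (lborel :: (real \<times> real) measure)
      (\<lambda>(u, \<tau>) t. stolct (a, b, c, d, u\<^sub>0, \<omega>\<^sub>0) g\<^sub>1 f\<^sub>1 u \<tau> *
                   window_atom (a, b, c, d, u\<^sub>0, \<omega>\<^sub>0) g\<^sub>2 u \<tau> t)
      (\<lambda>t. 2 * pi * L2_inner g\<^sub>2 g\<^sub>1 / ?s * f\<^sub>1 t)"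
    by (intro stolct_synthesis assms)
  have s: "csqrt (2 * of_real pi * of_real b * \<i>) = ?s"
    by (simp add: mult_ac)
  have ss: "?s * cnj ?s = of_real (2 * pi * \<bar>b\<bar>)"
    unfolding csqrt_mult_cnj by (simp add: norm_mult)
  have "f\<^sub>1 t = of_real \<bar>b\<bar> / (cnj ?s * L2_inner g\<^sub>2 g\<^sub>1) * (2 * pi * L2_inner g\<^sub>2 g\<^sub>1 / ?s * f\<^sub>1 t)" for t
  proof -
    have "of_real \<bar>b\<bar> / (cnj ?s * L2_inner g\<^sub>2 g\<^sub>1) * (2 * pi * L2_inner g\<^sub>2 g\<^sub>1 / ?s * f\<^sub>1 t)
        = of_real (2 * pi * \<bar>b\<bar>) / (?s * cnj ?s) * f\<^sub>1 t"
      using assms(6) by (simp add: field_simps)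
    also have "\<dots> = f\<^sub>1 t"
      unfolding ss using assms(2) by simp
    finally show ?thesis by simp
  qed
  then show "AE t in lborel. f\<^sub>1 t =
      of_real \<bar>b\<bar> / (cnj (csqrt (2 * of_real pi * of_real b * \<i>)) * L2_inner g\<^sub>2 g\<^sub>1) *
      (2 * pi * L2_inner g\<^sub>2 g\<^sub>1 / ?s * f\<^sub>1 t)"
    unfolding s by (intro AE_I2)
qed

end
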